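(* Let $m \geq 5$ be an integer. Then the propagation time of the helm graph $H_m$ is $$\mathrm{pt}(H_m) = \begin{cases} 6 & \text{if } m \equiv 0 \pmod 4,\\ 4 & \text{if } m \equiv 1 \pmod 4,\\ 5 & \text{if } m \equiv 2 \pmod 4,\\ 5 & \text{if } m \equiv 3 \pmod 4. \end{cases}$$
   Context: The helm graph $H_m$ is the (simple, undirected) graph with vertex set $\{v_0,v_1,\dots,v_m\} \cup \{p_1,\dots,p_m\}$ whose edges are: $v_0v_i$ for $1\le i\le m$; $v_iv_{i+1}$ for $1 \le i \le m-1$; $v_1v_m$; and $v_ip_i$ for $1\le i\le m$. That is, it is the wheel with center $v_0$ and $m$ spoke vertices, with one pendant vertex attached to each spoke vertex. Zero forcing: each vertex of a graph $G$ is initially colored blue or white. Color change rule: if $u$ is blue and $v$ is the only white neighbor of $u$, then $u$ can force $v$ to become blue; blue vertices stay blue. A set $B \subseteq V(G)$ is a zero forcing set of $G$ if, starting with exactly the vertices of $B$ blue, repeated application of the rule eventually makes every vertex blue. The zero forcing number $\mathrm{Z}(G)$ is the minimum cardinality of a zero forcing set of $G$. Propagation time: for a zero forcing set $B$ let $B^{[0]} = B$ and, for $k \geq 1$, let $B^{[k]} = B^{[k-1]} \cup B^{(k)}$, where $B^{(k)}$ is the set of all white vertices that can be forced by the color change rule when $B^{[k-1]}$ is exactly the set of blue vertices (all possible forces are performed simultaneously in each time-step). Then $\mathrm{pt}(G,B)$ is the least $k$ with $B^{[k]} = V(G)$, and $\mathrm{pt}(G) = \min\{\mathrm{pt}(G,B)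 : B \text{ is a zero forcing set of } G \text{ with } |B| = \mathrm{Z}(G)\}$. *)

theory Defs
  imports Main
begin

text \<open>A graph is a pair of a vertex set and a set of edges, each edge being a two-element set
  of vertices.\<close>

type_synonym 'a graph = "'a set \<times> 'a set set"

abbreviation verts :: "'a graph \<Rightarrow> 'a set" where
  "verts G \<equiv> fst G"

abbreviation edges :: "'a graph \<Rightarrow> 'a set set" where
  "edges G \<equiv> snd G"

definition finite_simple_graph :: "'a graph \<Rightarrow> bool" where
  "finite_simple_graph G \<longleftrightarrow>
     finite (verts G) \<and> (\<forall>e \<in> edges G. e \<subseteq> verts G \<and> card e = 2)"

definition neighbors :: "'a graph \<Rightarrow> 'a \<Rightarrow> 'a set" where
  "neighbors G u = {v. {u, v} \<in> edges G}"

definition forces :: "'a graph \<Rightarrow> 'a set \<Rightarrow> 'a \<Rightarrow> 'a \<Rightarrow> bool" where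
  "forces G B u v \<longleftrightarrow> u \<in> B \<and> neighbors G u - B = {v}"

text \<open>One application of the color change rule: a single force is performed.\<close>

definition color_change :: "'a graph \<Rightarrow> 'a set \<Rightarrow> 'a set \<Rightarrow> bool" where
  "color_change G B B' \<longleftrightarrow> (\<exists>u v. forces G B u v \<and> B' = insert v B)"

definition zero_forcing_set :: "'a graph \<Rightarrow> 'a set \<Rightarrow> bool" where
  "zero_forcing_set G B \<longleftrightarrow> B \<subseteq> verts G \<and> (color_change G)\<^sup>*\<^sup>* B (verts G)"

text \<open>The minima below (\<open>LEAST\<close>) are taken over nonempty sets of natural numbers when the graph
  is finite, since its full vertex set is then a zero forcing set.\<close>

definition zero_forcing_number :: "'a graph \<Rightarrow> nat" where
  "zero_forcing_number G = (LEAST n. \<exists>B. zero_forcing_set G B \<and> card B = n)"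

text \<open>\<open>blue_after G B k\<close> is $B^{[k]}$: all possible forces are performed simultaneously in each
  time step.\<close>

primrec blue_after :: "'a graph \<Rightarrow> 'a set \<Rightarrow> nat \<Rightarrow> 'a set" where
  "blue_after G B 0 = B"
| "blue_after G B (Suc k) =
     blue_after G B k \<union> {v. \<exists>u. forces G (blue_after G B k) u v}"

text \<open>Meaningful for zero forcing sets \<open>B\<close> only.\<close>

definition set_propagation_time :: "'a graph \<Rightarrow> 'a set \<Rightarrow> nat" where
  "set_propagation_time G B = (LEAST k. blue_after G B k = verts G)"

definition propagation_time :: "'a graph \<Rightarrow> nat" where
  "propagation_time G =
     (LEAST t. \<exists>B. zero_forcing_set G B \<and> card B = zero_forcing_number G
                   \<and> set_propagation_time G B = t)"

text \<open>\<open>V i\<close> is the vertex $v_i$ (so \<open>V 0\<close> is the center of the wheel) and \<open>P i\<close> the pendant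
  vertex $p_i$. The graph is the intended one for \<open>m \<ge> 3\<close>.\<close>

datatype helm_vertex = V nat | P nat

definition helm :: "nat \<Rightarrow> helm_vertex graph" where
  "helm m =
     (V ` {0..m} \<union> P ` {1..m},
      {{V 0, V i} | i. 1 \<le> i \<and> i \<le> m}
      \<union> {{V i, V (i + 1)} | i. 1 \<le> i \<and> i \<le> m - 1}
      \<union> {{V 1, V m}}
      \<union> {{V i, P i} | i. 1 \<le> i \<and> i \<le> m})"

lemma finite_simple_graph_helm:
  assumes "m \<ge> 3"
  shows "finite_simple_graph (helm m)"
  using assms by (auto simp: finite_simple_graph_def helm_def card_insert_if)

end

theory Submission
  imports Defs
begin

text \<open>
  Every vertex forces at most one vertex. A pendant \<open>p\<^sub>c\<close> that is not blue initially must be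
  forced by \<open>v\<^sub>c\<close>, so such a \<open>v\<^sub>c\<close> forces nothing else; hence all these \<open>v\<^sub>c\<close>, and the center,
  have to be forced by the center or by some \<open>v\<^sub>a\<close> with \<open>p\<^sub>a\<close> blue initially. Counting forcers
  shows that the zero forcing number is at least \<open>m / 2\<close> and leaves a minimum set \<open>B\<close>
  almost no slack: essentially \<open>B\<close> is a set \<open>A\<close> of pendants, possibly with the center.

  If the propagation is to be fast, then all but at most one of the \<open>v\<^sub>c\<close> have to be forced
  simultaneously, by those \<open>v\<^sub>a\<close> that sit at the end of a run of consecutive indices of \<open>A\<close>
  of length at least two. By the handshake lemma for the subgraph of the rim induced by \<open>A\<close>,
  this determines the parity of the size of \<open>A\<close>, and so \<open>m\<close> modulo 4. The starting set
  attaining the bounds has runs of two pendants, with one run of three to force the center.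
\<close>

section \<open>Zero forcing and simultaneous propagation\<close>

lemma blue_after_mono: "j \<le> k \<Longrightarrow> blue_after G B j \<subseteq> blue_after G B k"
  by (rule lift_Suc_mono_le) auto

lemma forces_superset:
  assumes "forces G B u v" "B \<subseteq> D" "v \<notin> D"
  shows "forces G D u v"
  using assms unfolding forces_def by blast

lemma neighbors_subset_verts: "finite_simple_graph G \<Longrightarrow> neighbors G u \<subseteq> verts G"
  unfolding finite_simple_graph_def neighbors_def by blast

lemma blue_after_subset_verts:
  assumes "finite_simple_graph G" "B \<subseteq> verts G"
  shows "blue_after G B k \<subseteq> verts G"
proof (induction k)
  case (Suc k)
  then show ?case
    using neighbors_subset_verts[OF assms(1)] by (auto simp: forces_def)
qed (use assms in simp)

text \<open>Forces available at the same time do not disturb each other: extra blue vertices keep a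
  force available unless its target is already blue. So one simultaneous step unfolds into single
  forces.\<close>

lemma color_change_simultaneous:
  assumes "finite W" "\<And>v. v \<in> W \<Longrightarrow> \<exists>u. forces G B u v"
  shows "(color_change G)\<^sup>*\<^sup>* B (B \<union> W)"
  using assms
proof (induction W)
  case (insert w W)
  then have *: "(color_change G)\<^sup>*\<^sup>* B (B \<union> W)"
    by blast
  show ?case
  proof (cases "w \<in> B \<union> W")
    case True
    then show ?thesis
      using * by (simp add: insert_absorb)
  next
    case False
    obtain u where "forces G B u w"
      using insert.prems by blast
    then have "forces G (B \<union> W) u w"
      using False by (blast intro: forces_superset)
    then have "color_change G (B \<union> W) (B \<union> insert w W)"
      unfolding color_change_def by auto
    then show ?thesis
      using * by (rule rtranclp.rtrancl_into_rtrancl[rotated])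
  qed
qed simp

lemma color_change_blue_after:
  assumes "finite_simple_graph G" "B \<subseteq> verts G"
  shows "(color_change G)\<^sup>*\<^sup>* B (blue_after G B k)"
proof (induction k)
  case (Suc k)
  let ?W = "{v. \<exists>u. forces G (blue_after G B k) u v}"
  have "?W \<subseteq> verts G"
    using neighbors_subset_verts[OF assms(1)] by (auto simp: forces_def)
  moreover have "finite (verts G)"
    using assms(1) unfolding finite_simple_graph_def by simp
  ultimately have "finite ?W"
    by (rule finite_subset)
  then have "(color_change G)\<^sup>*\<^sup>* (blue_after G B k) (blue_after G B (Suc k))"
    unfolding blue_after.simps by (rule color_change_simultaneous) blast
  with Suc show ?case
    by (rule rtranclp_trans)
qed simp

text \<open>Simultaneous propagation keeps up with any order of single forces: once it contains
  \<open>D\<close>, the next single force is still available or its target is already blue.\<close>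

lemma color_change_subset_blue_after:
  assumes "(color_change G)\<^sup>*\<^sup>* B B'"
  shows "\<exists>k. B' \<subseteq> blue_after G B k"
  using assms
proof (induction rule: rtranclp_induct)
  case base
  show ?case
    by (rule exI[of _ 0]) simp
next
  case (step D D')
  then obtain k u v where k: "D \<subseteq> blue_after G B k" and f: "forces G D u v" "D' = insert v D"
    unfolding color_change_def by blast
  then have "D' \<subseteq> blue_after G B (Suc k)"
    using forces_superset[OF f(1) k] by auto
  then show ?case
    by blast
qed

lemma zero_forcing_set_iff:
  assumes "finite_simple_graph G"
  shows "zero_forcing_set G B \<longleftrightarrow> B \<subseteq> verts G \<and> (\<exists>k. blue_after G B k = verts G)"
proof (cases "B \<subseteq> verts G")
  case True
  have "(color_change G)\<^sup>*\<^sup>* B (verts G)" if "blue_after G B k = verts G" for k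
    using color_change_blue_after[OF assms True, of k] that by simp
  moreover have "\<exists>k. blue_after G B k = verts G" if "(color_change G)\<^sup>*\<^sup>* B (verts G)"
    using color_change_subset_blue_after[OF that] blue_after_subset_verts[OF assms True]
    by blast
  ultimately show ?thesis
    using True unfolding zero_forcing_set_def by blast
qed (simp add: zero_forcing_set_def)

text \<open>One set \<open>B\<close> attaining both bounds settles both nested minima. The bounds
  speak of \<open>blue_after\<close> only, so orders of single forces do not occur from here
  on.\<close>

lemma propagation_time_eqI:
  assumes G: "finite_simple_graph G"
    and B: "B \<subseteq> verts G" "card B = n" "blue_after G B t = verts G"
    and n_le: "\<And>B k. B \<subseteq> verts G \<Longrightarrow> blue_after G B k = verts G \<Longrightarrow> n \<le> card B"
    and t_le: "\<And>B k. B \<subseteq> verts G \<Longrightarrow> blue_after G B k = verts G \<Longrightarrow> card B = n \<Longrightarrow> t \<le> k"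
  shows "propagation_time G = t"
proof -
  note zf = zero_forcing_set_iff[OF G]
  have zfB: "zero_forcing_set G B"
    unfolding zf using B by blast
  have Z: "zero_forcing_number G = n"
    unfolding zero_forcing_number_def
  proof (rule Least_equality)
    show "\<exists>B. zero_forcing_set G B \<and> card B = n"
      using zfB B(2) by blast
    show "n \<le> n'" if "\<exists>B. zero_forcing_set G B \<and> card B = n'" for n'
      using that n_le unfolding zf by auto
  qed
  have "set_propagation_time G B = t"
    unfolding set_propagation_time_def
    by (rule Least_equality) (use B t_le in auto)
  moreover have "t \<le> set_propagation_time G B'" if B': "zero_forcing_set G B'" "card B' = n" for B'
  proof -
    obtain k where "B' \<subseteq> verts G" "blue_after G B' k = verts G"
      using B'(1) unfolding zf by auto
    then show ?thesis
      using t_le[of B'] B'(2) LeastI[of "\<lambda>k. blue_after G B' k = verts G" k]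
      unfolding set_propagation_time_def by simp
  qed
  ultimately show ?thesis
    unfolding propagation_time_def Z using zfB B(2)
    by (intro Least_equality) auto
qed

section \<open>Neighbourhoods in helm graphs\<close>

definition nxt :: "nat \<Rightarrow> nat \<Rightarrow> nat" where
  "nxt m i = (if i = m then 1 else i + 1)"

definition prv :: "nat \<Rightarrow> nat \<Rightarrow> nat" where
  "prv m i = (if i = 1 then m else i - 1)"

lemma nxt_prv_range:
  assumes "i \<in> {1..m}"
  shows "nxt m i \<in> {1..m}" "prv m i \<in> {1..m}"
  using assms by (auto simp: nxt_def prv_def)

lemma nxt_prv_inverse:
  assumes "i \<in> {1..m}"
  shows "prv m (nxt m i) = i" "nxt m (prv m i) = i"
  using assms by (auto simp: nxt_def prv_def)

lemma nxt_neq_prv: "m \<ge> 3 \<Longrightarrow> i \<in> {1..m} \<Longrightarrow> nxt m i \<noteq> prv m i"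
  by (auto simp: nxt_def prv_def)

lemma neighbors_center:
  assumes "m \<ge> 3"
  shows "neighbors (helm m) (V 0) = V ` {1..m}"
  using assms by (auto simp: neighbors_def helm_def doubleton_eq_iff)

lemma neighbors_spoke:
  assumes "m \<ge> 3" "i \<in> {1..m}"
  shows "neighbors (helm m) (V i) = {V 0, P i, V (nxt m i), V (prv m i)}"
proof
  show "neighbors (helm m) (V i) \<subseteq> {V 0, P i, V (nxt m i), V (prv m i)}"
    using assms by (auto simp: neighbors_def helm_def doubleton_eq_iff nxt_def prv_def)
  have "V (prv m i) \<in> neighbors (helm m) (V i)"
  proof (cases "i = 1")
    case False
    then have "i = (i - 1) + 1" "1 \<le> i - 1" "i - 1 \<le> m - 1"
      using assms by auto
    then have "{V i, V (i - 1)} \<in> {{V j, V (j + 1)} | j. 1 \<le> j \<and> j \<le> m - 1}"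
      by (intro CollectI exI[of _ "i - 1"]) (simp add: insert_commute)
    then show ?thesis
      using False by (simp add: neighbors_def helm_def prv_def)
  qed (use assms in \<open>auto simp: neighbors_def helm_def prv_def\<close>)
  then show "{V 0, P i, V (nxt m i), V (prv m i)} \<subseteq> neighbors (helm m) (V i)"
    using assms by (auto simp: neighbors_def helm_def doubleton_eq_iff nxt_def)
qed

lemma neighbors_pendant:
  assumes "i \<in> {1..m}"
  shows "neighbors (helm m) (P i) = {V i}"
  using assms by (auto simp: neighbors_def helm_def doubleton_eq_iff)

text \<open>Both sides count the steps of \<open>nxt\<close> that stay inside \<open>A\<close>, by
  their starting points and by their end points.\<close>

lemma card_nxt_eq_card_prv:
  assumes "A \<subseteq> {1..m}"
  shows "card {i \<in> A. nxt m i \<in> A} = card {i \<in> A. prv m i \<in> A}"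
proof (rule bij_betw_same_card)
  show "bij_betw (nxt m) {i \<in> A. nxt m i \<in> A} {i \<in> A. prv m i \<in> A}"
    by (rule bij_betw_byWitness[where f' = "prv m"])
      (use assms nxt_prv_inverse in \<open>auto simp: subset_iff\<close>)
qed

section \<open>Lower bounds\<close>

text \<open>Handshake lemma for the subgraph of the cycle induced by \<open>A\<close>, in which the vertices of
  \<open>A - K\<close> have degree 2 and those of \<open>K\<close> degree 1.\<close>

lemma even_card_run_ends:
  assumes A: "A \<subseteq> {1..m}" and "K \<subseteq> A"
    and K: "\<And>a. a \<in> K \<Longrightarrow> (nxt m a \<in> A) \<noteq> (prv m a \<in> A)"
    and both: "\<And>a. a \<in> A - K \<Longrightarrow> nxt m a \<in> A \<and> prv m a \<in> A"
  shows "even (card A + card (A - K))"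
proof -
  let ?X = "{i \<in> A. nxt m i \<in> A}" and ?Y = "{i \<in> A. prv m i \<in> A}"
  have fin: "finite A"
    using A finite_subset by blast
  have "?X \<union> ?Y = A" "?X \<inter> ?Y = A - K"
    using assms by blast+
  then have "card A + card (A - K) = card ?X + card ?Y"
    using card_Un_Int[of ?X ?Y] fin by simp
  then show ?thesis
    using card_nxt_eq_card_prv[OF A] by simp
qed

text \<open>In the applications \<open>F\<close> is a forcing relation. It is single-valued in the
  forcer, so distinct targets need distinct forcers.\<close>

lemma card_le_card_if_functional:
  assumes "finite X"
    and "\<And>r. r \<in> R \<Longrightarrow> \<exists>u\<in>X. F u r"
    and "\<And>u r s. F u r \<Longrightarrow> F u s \<Longrightarrow> r = s"
  shows "card R \<le> card X"
proof -
  have "R \<subseteq> (\<lambda>u. THE r. F u r) ` X"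
  proof
    fix r
    assume "r \<in> R"
    then obtain u where u: "u \<in> X" "F u r"
      using assms(2) by blast
    then have "(THE r. F u r) = r"
      using assms(3) by blast
    then show "r \<in> (\<lambda>u. THE r. F u r) ` X"
      using u(1) by force
  qed
  then show ?thesis
    by (rule surj_card_le[OF assms(1)])
qed

section \<open>Forcing relation of an arbitrary starting set\<close>

locale helm_forcing =
  fixes m :: nat and B :: "helm_vertex set" and T :: nat
  assumes m5: "m \<ge> 5"
    and B_verts: "B \<subseteq> verts (helm m)"
    and all_blue: "blue_after (helm m) B T = verts (helm m)"
begin

abbreviation D :: "nat \<Rightarrow> helm_vertex set" where
  "D \<equiv> blue_after (helm m) B"

text \<open>\<open>A\<close> and \<open>C\<close> split the rim indices by whether the pendant is
  blue initially. A spoke over \<open>C\<close> is tied to forcing its own pendant; spokes over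
  \<open>C\<close> and the center can be forced only from the center and the spokes over
  \<open>A\<close>.\<close>

definition A :: "nat set" where "A = {i \<in> {1..m}. P i \<in> B}"
definition C :: "nat set" where "C = {i \<in> {1..m}. P i \<notin> B}"
definition S :: "nat set" where "S = {i \<in> {1..m}. V i \<in> B}"

text \<open>Time is forgotten. Several vertices may force the same target in one step, so
  \<open>F\<close> is a partial function of the forcer but not of the target.\<close>

definition F :: "helm_vertex \<Rightarrow> helm_vertex \<Rightarrow> bool" where
  "F u v \<longleftrightarrow> (\<exists>k. forces (helm m) (D k) u v)"

lemma m3: "m \<ge> 3"
  using m5 by simp

lemmas nbs = neighbors_center[OF m3] neighbors_spoke[OF m3] neighbors_pendant

text \<open>After \<open>u\<close> has forced, all its neighbours are blue, so it has nothing left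
  to force in a later step.\<close>

lemma forces_functional:
  assumes "forces (helm m) (D i) u v" "forces (helm m) (D j) u w" "i \<le> j"
  shows "v = w"
proof (rule ccontr)
  assume "v \<noteq> w"
  then have "i \<noteq> j"
    using assms unfolding forces_def by auto
  then have "D (Suc i) \<subseteq> D j"
    using assms(3) by (intro blue_after_mono) simp
  then have "v \<in> D j" "D i \<subseteq> D j"
    using assms(1) by auto
  moreover have "w \<in> neighbors (helm m) u - D j" "neighbors (helm m) u - D i = {v}"
    using assms(1,2) by (simp_all add: forces_def)
  ultimately have "w \<in> {v}"
    by blast
  then show False
    using \<open>v \<noteq> w\<close> by blast
qed

lemma F_functional: "F u v \<Longrightarrow> F u w \<Longrightarrow> v = w"
  unfolding F_def using forces_functional by (metis nle_le)

lemma forced_before: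
  assumes "v \<in> D k" "v \<notin> B"
  shows "\<exists>j<k. \<exists>u. forces (helm m) (D j) u v"
  using assms(1)
proof (induction k)
  case (Suc k)
  show ?case
  proof (cases "v \<in> D k")
    case True
    then show ?thesis
      using Suc.IH less_SucI by blast
  next
    case False
    then show ?thesis
      using Suc.prems by auto
  qed
qed (use assms in simp)

lemma F_exists:
  assumes "v \<in> verts (helm m)" "v \<notin> B"
  shows "\<exists>u. F u v"
  using forced_before[of v T] assms all_blue unfolding F_def by blast

lemma fin: "finite A" "finite C" "finite S"
  unfolding A_def C_def S_def by simp_all

lemma AC: "A \<union> C = {1..m}" "A \<inter> C = {}"
  unfolding A_def C_def by auto

lemma C_iff: "i \<in> {1..m} \<Longrightarrow> i \<in> C \<longleftrightarrow> i \<notin> A"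
  using AC by blast

lemma A_range: "a \<in> A \<Longrightarrow> a \<in> {1..m}"
  using AC by blast

lemma C_range: "c \<in> C \<Longrightarrow> c \<in> {1..m}"
  using AC by blast

lemma forces_pendantD:
  assumes "forces (helm m) X u (P i)"
  shows "i \<in> {1..m} \<and> u = V i"
proof -
  have "P i \<in> neighbors (helm m) u"
    using assms unfolding forces_def by blast
  then show ?thesis
    by (auto simp: neighbors_def helm_def doubleton_eq_iff)
qed

lemma forces_spokeD:
  assumes "forces (helm m) X u (V i)" "i \<in> {1..m}"
  shows "u = V 0 \<or> u = P i \<or> (\<exists>a\<in>{1..m}. u = V a)"
proof -
  have "V i \<in> neighbors (helm m) u"
    using assms unfolding forces_def by blast
  then show ?thesis
    using assms(2) m5 by (auto simp: neighbors_def helm_def doubleton_eq_iff)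
qed

lemma forces_centerD:
  assumes "forces (helm m) X u (V 0)"
  shows "\<exists>a\<in>{1..m}. u = V a"
proof -
  have "V 0 \<in> neighbors (helm m) u"
    using assms unfolding forces_def by blast
  then show ?thesis
    using m5 by (auto simp: neighbors_def helm_def doubleton_eq_iff)
qed

text \<open>\<open>V c\<close> is the only neighbour of \<open>P c\<close>, hence its only possible
  forcer, and must be blue one step earlier.\<close>

lemma pendant_blue_imp_spoke_blue:
  assumes "c \<in> C" "P c \<in> D (Suc k)"
  shows "V c \<in> D k"
proof -
  obtain j u where "j < Suc k" and f: "forces (helm m) (D j) u (P c)"
    using forced_before[OF assms(2)] assms(1) by (auto simp: C_def)
  then have "V c \<in> D j"
    using forces_pendantD[OF f] by (simp add: forces_def)
  then show ?thesis
    using blue_after_mono[of j k "helm m" B] \<open>j < Suc k\<close> by auto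
qed

lemma pendant_not_forcing:
  assumes "c \<in> C"
  shows "\<not> forces (helm m) (D k) (P c) (V c)"
proof
  assume f: "forces (helm m) (D k) (P c) (V c)"
  then have "P c \<in> D (Suc k)" "V c \<notin> D k"
    unfolding forces_def by auto
  then show False
    using pendant_blue_imp_spoke_blue[OF assms] by blast
qed

text \<open>\<open>P c\<close> is white initially and only \<open>V c\<close> can force it; this
  uses up the single force of \<open>V c\<close>.\<close>

lemma F_outer:
  assumes "c \<in> C"
  shows "F (V c) v \<longleftrightarrow> v = P c"
proof -
  have "P c \<in> verts (helm m)" "P c \<notin> B"
    using assms by (auto simp: C_def helm_def)
  then have "F (V c) (P c)"
    using F_exists forces_pendantD unfolding F_def by blast
  then show ?thesis
    using F_functional by blast
qed

text \<open>Of the neighbours of \<open>V c\<close>, its pendant turns blue too late to force it,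
  and a spoke over \<open>C\<close> spends its force on its own pendant.\<close>

lemma F_spokeD:
  assumes "F u (V c)" "c \<in> C"
  shows "u = V 0 \<or> (\<exists>a\<in>A. u = V a)"
proof -
  obtain k where f: "forces (helm m) (D k) u (V c)"
    using assms unfolding F_def by blast
  have "c \<in> {1..m}"
    using assms AC by auto
  then consider "u = V 0" | "u = P c" | a where "a \<in> {1..m}" "u = V a"
    using forces_spokeD[OF f] by blast
  then show ?thesis
  proof cases
    case 2
    then show ?thesis
      using pendant_not_forcing assms f by blast
  next
    case 3
    then show ?thesis
      using F_outer[of a "V c"] assms(1) AC by blast
  qed simp
qed

lemma F_centerD:
  assumes "F u (V 0)"
  shows "\<exists>a\<in>A. u = V a"
proof -
  obtain a where a: "a \<in> {1..m}" "u = V a"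
    using assms forces_centerD unfolding F_def by blast
  then have "a \<notin> C"
    using F_outer[of a "V 0"] assms by blast
  then show ?thesis
    using a AC by blast
qed

section \<open>Counting forcers\<close>

lemma needs_forcer:
  assumes "c \<in> C - S"
  shows "\<exists>u. F u (V c) \<and> (u = V 0 \<or> u \<in> V ` A)"
proof -
  have "V c \<in> verts (helm m)" "V c \<notin> B"
    using assms by (auto simp: C_def S_def helm_def)
  then show ?thesis
    using F_exists F_spokeD assms by blast
qed

lemma center_needs_forcer:
  assumes "V 0 \<notin> B"
  shows "\<exists>u\<in>V ` A. F u (V 0)"
  using F_exists[of "V 0"] F_centerD assms by (auto simp: helm_def)

lemma card_V_image: "card (V ` X) = card X"
  by (simp add: card_image inj_on_def)

lemma card_needing_forcer:
  "card (V ` (C - S) \<union> ({V 0} - B)) = card (C - S) + card ({V 0} - B)"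
proof -
  have "V ` (C - S) \<inter> ({V 0} - B) = {}"
    using AC by auto
  then have "card (V ` (C - S) \<union> ({V 0} - B)) = card (V ` (C - S)) + card ({V 0} - B)"
    using fin by (intro card_Un_disjoint) auto
  then show ?thesis
    by (simp add: card_V_image)
qed

text \<open>The left side counts the targets: the initially white spokes over \<open>C\<close> and
  the center if it is white. The right side counts the possible forcers: the spokes over
  \<open>A\<close> and the center.\<close>

lemma forcer_count: "card (C - S) + card ({V 0} - B) \<le> card A + 1"
proof -
  have "card (V ` (C - S) \<union> ({V 0} - B)) \<le> card (insert (V 0) (V ` A))"
    by (rule card_le_card_if_functional[where F = F, OF _ _ F_functional])
      (use fin needs_forcer center_needs_forcer in blast)+
  also have "\<dots> \<le> card A + 1"
    using fin by (simp add: card_insert_if card_V_image)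
  finally show ?thesis
    by (simp add: card_needing_forcer)
qed

text \<open>The targets outnumber the spokes over \<open>A\<close>, so the center has to force one
  of them.\<close>

lemma center_forces:
  assumes "card A < card (C - S) + card ({V 0} - B)"
  shows "\<exists>b\<in>C. F (V 0) (V b)"
proof (rule ccontr)
  assume "\<not> ?thesis"
  then have "card (V ` (C - S) \<union> ({V 0} - B)) \<le> card (V ` A)"
    by (intro card_le_card_if_functional[where F = F, OF _ _ F_functional])
      (use fin needs_forcer center_needs_forcer in blast)+
  then show False
    using assms by (simp add: card_needing_forcer card_V_image)
qed

lemma card_A_C: "card A + card C = m"
  using card_Un_disjoint[OF fin(1,2) AC(2)] AC(1) by simp

lemma card_B: "card B = card A + card S + card ({V 0} \<inter> B)"
proof -
  have "B = P ` A \<union> (V ` S \<union> ({V 0} \<inter> B))"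
  proof (intro subset_antisym subsetI)
    fix x
    assume "x \<in> B"
    then show "x \<in> P ` A \<union> (V ` S \<union> ({V 0} \<inter> B))"
      using B_verts by (cases x) (auto simp: A_def S_def helm_def)
  qed (auto simp: A_def S_def)
  then have "card B = card (P ` A \<union> (V ` S \<union> ({V 0} \<inter> B)))"
    by simp
  also have "\<dots> = card (P ` A) + (card (V ` S) + card ({V 0} \<inter> B))"
    using fin by (subst card_Un_disjoint; (subst card_Un_disjoint)?; auto simp: S_def)
  finally show ?thesis
    by (simp add: card_image inj_on_def)
qed

text \<open>The extra terms on the left measure the slack: if \<open>2 * card B\<close> is
  \<open>m\<close>, then \<open>B\<close> consists of pendants only; if it is \<open>m + 1\<close>,
  at most one vertex of \<open>B\<close> is not a pendant.\<close>

lemma card_lower_bound: "m + card S + card ({V 0} \<inter> B) \<le> 2 * card B"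
proof -
  have "card C \<le> card (C - S) + card S"
    using card_Un_le[of "C - S" "C \<inter> S"] card_mono[of S "C \<inter> S"] fin
    by (simp add: Un_Diff_Int)
  moreover have "card ({V 0} - B) + card ({V 0} \<inter> B) = 1"
    by (cases "V 0 \<in> B") (simp_all add: insert_Diff_if)
  ultimately show ?thesis
    using forcer_count card_A_C card_B by linarith
qed

section \<open>When spokes and the center turn blue\<close>

lemma D_le: "j \<le> k \<Longrightarrow> x \<in> D j \<Longrightarrow> x \<in> D k"
  using blue_after_mono[of j k "helm m" B] by blast

lemma forces_whiteD:
  assumes "forces (helm m) X u v"
  shows "v \<in> neighbors (helm m) u" "v \<notin> X" "u \<in> X"
    and "w \<in> neighbors (helm m) u \<Longrightarrow> w \<noteq> v \<Longrightarrow> w \<in> X"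
  using assms unfolding forces_def by blast+

lemma inner_blue:
  assumes "a \<in> A"
  shows "V a \<in> D (Suc k)"
proof -
  have a: "a \<in> {1..m}" "P a \<in> B"
    using assms by (auto simp: A_def)
  have "V a \<in> D (Suc 0)"
  proof (cases "V a \<in> B")
    case False
    then have "forces (helm m) (D 0) (P a) (V a)"
      using a nbs(3) by (auto simp: forces_def)
    then show ?thesis
      by auto
  qed simp
  then show ?thesis
    by (rule D_le[rotated]) simp
qed

text \<open>The final step is taken up by the pendants over \<open>C\<close>: their spokes must be
  blue one step before the end.\<close>

lemma outer_blue_before:
  assumes "D (Suc k) = verts (helm m)" "c \<in> C"
  shows "V c \<in> D k"
proof (rule pendant_blue_imp_spoke_blue[OF assms(2)])
  show "P c \<in> D (Suc k)"
    unfolding assms(1) using assms(2) by (auto simp: C_def helm_def)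
qed

text \<open>The center forces only once every other spoke is blue, so \<open>V b\<close> turns blue
  strictly after all other spokes. Together with \<open>outer_blue_before\<close> this costs two
  steps at the end.\<close>

lemma center_forces_last:
  assumes "F (V 0) (V b)" "V b \<in> D (Suc k)" "c \<in> {1..m} - {b}"
  shows "V c \<in> D k"
proof -
  obtain j where f: "forces (helm m) (D j) (V 0) (V b)"
    using assms(1) unfolding F_def by blast
  then have "V b \<notin> D j"
    by (rule forces_whiteD)
  then have "j \<le> k"
    using assms(2) D_le[of "Suc k" j] by (meson not_less_eq_eq)
  moreover have "V c \<in> D j"
    using forces_whiteD(4)[OF f, of "V c"] assms(3) nbs(1) by auto
  ultimately show ?thesis
    by (rule D_le)
qed

lemma spoke_step:
  assumes "c \<in> C" "V c \<in> D (Suc k)" "V c \<notin> D k"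
  shows "forces (helm m) (D k) (V 0) (V c) \<or> (\<exists>a\<in>A. forces (helm m) (D k) (V a) (V c))"
proof -
  obtain u where f: "forces (helm m) (D k) u (V c)"
    using assms by auto
  then have "F u (V c)"
    unfolding F_def by blast
  then show ?thesis
    using F_spokeD[OF _ assms(1)] f by blast
qed

text \<open>The forcer is the center itself or a spoke, and a spoke forces along the rim only when
  its neighbour \<open>V 0\<close> is already blue.\<close>

lemma spoke_step_center_blue:
  assumes "c \<in> C" "V c \<in> D (Suc k)" "V c \<notin> D k"
  shows "V 0 \<in> D k"
  using spoke_step[OF assms]
proof
  assume "\<exists>a\<in>A. forces (helm m) (D k) (V a) (V c)"
  then obtain a where a: "a \<in> {1..m}" and f: "forces (helm m) (D k) (V a) (V c)"
    using AC by blast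
  have "c \<noteq> 0"
    using assms(1) AC by auto
  then show ?thesis
    using forces_whiteD(4)[OF f, of "V 0"] nbs(2)[OF a] by simp
qed (rule forces_whiteD)

text \<open>The ends of the runs of at least two consecutive indices of \<open>A\<close>: an
  isolated index has no rim neighbour in \<open>A\<close>, an interior one has two.\<close>

definition K :: "nat set" where
  "K = {a \<in> A. (nxt m a \<in> A) \<noteq> (prv m a \<in> A)}"

text \<open>The key step: when the blue spokes are exactly those in \<open>A\<close>, the spoke of \<open>a\<close> can force
  along the rim only if it has one blue and one white rim neighbour.\<close>

lemma card_forced_le_card_K:
  assumes exact: "\<And>i. i \<in> {1..m} \<Longrightarrow> V i \<in> D k \<longleftrightarrow> i \<in> A"
    and "R \<subseteq> C" and R: "\<And>c. c \<in> R \<Longrightarrow> V c \<in> D (Suc k)"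
    and "card C \<ge> 2"
  shows "card R \<le> card K"
proof (rule card_le_card_if_functional[where F = "\<lambda>a c. forces (helm m) (D k) (V a) (V c)"])
  show "finite K"
    using fin unfolding K_def by simp
  show "c = d" if "forces (helm m) (D k) (V a) (V c)" "forces (helm m) (D k) (V a) (V d)" for a c d
    using that unfolding forces_def by auto
  show "\<exists>a\<in>K. forces (helm m) (D k) (V a) (V c)" if cR: "c \<in> R" for c
  proof -
    have c: "c \<in> C" "c \<in> {1..m}" "c \<notin> A"
      using cR \<open>R \<subseteq> C\<close> AC by auto
    \<comment> \<open>All spokes over \<open>C\<close> are white at time \<open>k\<close>, and there
      are at least two of them.\<close>
    have "\<not> forces (helm m) (D k) (V 0) (V c)"
    proof
      assume f: "forces (helm m) (D k) (V 0) (V c)"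
      have "C \<subseteq> {c}"
      proof
        fix d
        assume "d \<in> C"
        then have "V d \<notin> D k" "V d \<in> neighbors (helm m) (V 0)"
          using exact C_iff C_range nbs(1) by blast+
        then show "d \<in> {c}"
          using forces_whiteD(4)[OF f] by auto
      qed
      then have "card C \<le> 1"
        using card_mono[of "{c}" C] by simp
      then show False
        using \<open>card C \<ge> 2\<close> by simp
    qed
    then obtain a where "a \<in> A" and f: "forces (helm m) (D k) (V a) (V c)"
      using spoke_step[of c k] c R[OF cR] exact by blast
    have a: "a \<in> {1..m}"
      using \<open>a \<in> A\<close> AC by blast
    note r = nxt_prv_range[OF a]
    have "c = nxt m a \<or> c = prv m a"
      using forces_whiteD(1)[OF f] nbs(2)[OF a] c by auto
    moreover have "i \<in> A" if "i = nxt m a \<or> i = prv m a" "i \<noteq> c" for i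
      using forces_whiteD(4)[OF f, of "V i"] nbs(2)[OF a] exact[of i] r that by auto
    ultimately have "(nxt m a \<in> A) \<noteq> (prv m a \<in> A)"
      using nxt_neq_prv[OF m3 a] c(3) by metis
    then have "a \<in> K"
      using \<open>a \<in> A\<close> unfolding K_def by blast
    then show ?thesis
      using f by blast
  qed
qed

text \<open>Step 4 is reserved for pendants and step 3 for the spoke \<open>V b\<close> forced by
  the center. The other \<open>card A\<close> spokes over \<open>C\<close> are therefore forced from
  time 1, where the blue spokes are those over \<open>A\<close>. So every index of \<open>A\<close>
  is a run end, and the handshake count gives the parity.\<close>

lemma center_blue_even:
  assumes "V 0 \<in> B" "S = {}" "card C = card A + 1" "card A \<ge> 1"
    and T4: "D 4 = verts (helm m)"
  shows "even (card A)"
proof -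
  obtain b where b: "b \<in> C" "F (V 0) (V b)"
    using center_forces assms(2,3) by auto
  have C3: "V c \<in> D 3" if "c \<in> C" for c
    using outer_blue_before[of 3 c] that T4 by simp
  \<comment> \<open>At time 0 no spoke is blue, so no spoke forces, and the center has more than one
    white neighbour; only pendants over \<open>A\<close> act in the first step.\<close>
  have exact: "V i \<in> D 1 \<longleftrightarrow> i \<in> A" if i: "i \<in> {1..m}" for i
  proof
    assume "V i \<in> D 1"
    show "i \<in> A"
    proof (rule ccontr)
      assume "i \<notin> A"
      then have iC: "i \<in> C"
        using AC i by blast
      have S0: "V j \<notin> D 0" if "j \<in> {1..m}" for j
        using that \<open>S = {}\<close> by (auto simp: S_def)
      have "forces (helm m) (D 0) (V 0) (V i) \<or> (\<exists>a\<in>A. forces (helm m) (D 0) (V a) (V i))"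
        using spoke_step[OF iC, of 0] \<open>V i \<in> D 1\<close> S0[OF i] by simp
      then have "forces (helm m) (D 0) (V 0) (V i)"
        using forces_whiteD(3) S0 AC by blast
      then have "V (nxt m i) \<in> D 0"
        using forces_whiteD(4)[of "D 0" "V 0" "V i" "V (nxt m i)"] nbs(1)
          nxt_prv_range[OF i] nxt_neq_prv[OF m3 i] m5 by (auto simp: nxt_def split: if_splits)
      then show False
        using S0 nxt_prv_range[OF i] by blast
    qed
  qed (use inner_blue[of i 0] in simp)
  have "card (C - {b}) \<le> card K"
  proof (rule card_forced_le_card_K[where k = 1])
    show "V c \<in> D (Suc 1)" if "c \<in> C - {b}" for c
      using center_forces_last[OF b(2), of 2 c] C3[OF b(1)] C_range[of c] that
      by (simp add: eval_nat_numeral del: blue_after.simps)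
  qed (use exact assms in auto)
  moreover have "card (C - {b}) = card A"
    using b fin assms(3) by simp
  ultimately have "K = A"
    using fin card_seteq[of A K] unfolding K_def by auto
  then have "(nxt m a \<in> A) \<noteq> (prv m a \<in> A)" if "a \<in> A" for a
    using that unfolding K_def by blast
  then show ?thesis
    using even_card_run_ends[of A m A] A_range by fastforce
qed

text \<open>Now the spokes over \<open>C\<close> other than \<open>V b\<close> would have to be
  forced from time 0, when no spoke is blue.\<close>

lemma center_blue_not_3:
  assumes "V 0 \<in> B" "S = {}" "card C = card A + 1" "card A \<ge> 1"
  shows "D 3 \<noteq> verts (helm m)"
proof
  assume "D 3 = verts (helm m)"
  then have C2: "V c \<in> D 2" if "c \<in> C" for c
    using outer_blue_before[of 2 c] that by simp
  obtain b where b: "b \<in> C" "F (V 0) (V b)"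
    using center_forces assms(2,3) by auto
  have C1: "V c \<in> D 1" if "c \<in> C - {b}" for c
    using center_forces_last[OF b(2), of 1 c] C2[OF b(1)] C_range[of c] that
    by (simp add: eval_nat_numeral del: blue_after.simps)
  have "card C \<ge> 2"
    using assms by simp
  then have "C - {b} \<noteq> {}"
    using b fin by (metis One_nat_def card.empty card_Diff_singleton diff_is_0_eq not_less_eq_eq numeral_2_eq_2)
  then obtain c where c: "c \<in> C - {b}"
    by blast
  have S0: "V j \<notin> D 0" if "j \<in> {1..m}" for j
    using that \<open>S = {}\<close> by (auto simp: S_def)
  have "forces (helm m) (D 0) (V 0) (V c) \<or> (\<exists>a\<in>A. forces (helm m) (D 0) (V a) (V c))"
    using spoke_step[of c 0] C1[OF c] c S0[OF C_range] by fastforce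
  then have "forces (helm m) (D 0) (V 0) (V c)"
    using forces_whiteD(3) S0 AC by blast
  then have "V b \<in> D 0"
    using forces_whiteD(4)[of "D 0" "V 0" "V c" "V b"] nbs(1) b c AC by auto
  then show False
    using S0 b AC by blast
qed

text \<open>To force the center in the first step, a spoke and its rim neighbours must be blue
  initially, which exceeds the single element allowed in \<open>S\<close>.\<close>

lemma center_white_1:
  assumes "V 0 \<notin> B" "card S \<le> 1"
  shows "V 0 \<notin> D 1"
proof
  assume "V 0 \<in> D 1"
  then obtain u where f: "forces (helm m) (D 0) u (V 0)"
    using assms(1) by auto
  then obtain a where a: "a \<in> {1..m}" "u = V a"
    using forces_centerD by blast
  note r = nxt_prv_range[OF a(1)]
  have "V (nxt m a) \<in> D 0" "V a \<in> D 0"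
    using forces_whiteD(3,4)[OF f] nbs(2)[OF a(1)] a r by auto
  then have "{a, nxt m a} \<subseteq> S"
    using a r by (auto simp: S_def)
  then have "card {a, nxt m a} \<le> 1"
    using card_mono[OF fin(3)] assms(2) by (meson order_trans)
  then show False
    using m5 by (auto simp: nxt_def card_insert_if split: if_splits)
qed

text \<open>A spoke over \<open>C\<close> is forced only when the center is already blue, which is
  not the case at times 0 and 1.\<close>

lemma center_white_spokes_2:
  assumes "V 0 \<notin> B" "card S \<le> 1" "c \<in> C" "V c \<in> D 2"
  shows "c \<in> S"
proof -
  have "V c \<in> D 1"
    using spoke_step_center_blue[OF assms(3), of 1] assms(4) center_white_1[OF assms(1,2)]
    unfolding numeral_2_eq_2 One_nat_def by blast
  then have "V c \<in> D 0"
    using spoke_step_center_blue[OF assms(3), of 0] assms(1)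
    unfolding One_nat_def blue_after.simps(1) by blast
  then show ?thesis
    using C_range[OF assms(3)] by (simp add: S_def)
qed

text \<open>At time 2 the blue spokes are those over \<open>A\<close>, so the targets in
  \<open>R\<close> need \<open>card A - 1\<close> run ends. The index whose spoke forced the center
  is interior to a run, hence it is the only one outside \<open>K\<close>, and the handshake count
  gives the parity.\<close>

lemma center_white_odd:
  assumes "V 0 \<notin> B" "S = {}" "card C \<ge> 2" "R \<subseteq> C" "R \<noteq> {}"
    and R: "\<And>c. c \<in> R \<Longrightarrow> V c \<in> D 3"
    and card_A: "card A = card R + 1"
  shows "odd (card A)"
proof -
  have exact: "V i \<in> D 2 \<longleftrightarrow> i \<in> A" if "i \<in> {1..m}" for i
  proof
    show "i \<in> A" if "V i \<in> D 2"
      using center_white_spokes_2[OF assms(1) _ _ that] C_iff[OF \<open>i \<in> {1..m}\<close>] assms(2) by auto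
    show "V i \<in> D 2" if "i \<in> A"
      using inner_blue[OF that, of 1] unfolding numeral_2_eq_2 One_nat_def .
  qed
  have K_le: "K \<subseteq> A"
    unfolding K_def by blast
  have le: "card R \<le> card K"
  proof (rule card_forced_le_card_K[OF exact assms(4) _ assms(3)])
    show "V c \<in> D (Suc 2)" if "c \<in> R" for c
      using R[OF that] by (simp add: eval_nat_numeral del: blue_after.simps)
  qed
  obtain c where c: "c \<in> R"
    using assms(5) by blast
  then have "V c \<notin> D 2"
    using center_white_spokes_2[of c] assms(1,2,4) by auto
  then have "V 0 \<in> D 2"
    using spoke_step_center_blue[of c 2] R[OF c] c assms(4)
    by (auto simp: eval_nat_numeral simp del: blue_after.simps)
  then obtain j u where j: "j < 2" and f: "forces (helm m) (D j) u (V 0)"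
    using forced_before[of "V 0" 2] assms(1) by blast
  then obtain a where a: "a \<in> {1..m}" "u = V a"
    using forces_centerD[OF f] by blast
  note r = nxt_prv_range[OF a(1)]
  \<comment> \<open>Forcing the center requires \<open>V a\<close> and both its rim neighbours to be
    blue, so these three indices lie in \<open>A\<close>.\<close>
  have both: "V i \<in> D 2" if "i = a \<or> i = nxt m a \<or> i = prv m a" for i
  proof -
    have "V i \<in> D j"
    proof (cases "i = a")
      case True
      then show ?thesis
        using forces_whiteD(3)[OF f] a(2) by simp
    next
      case False
      then have i: "i = nxt m a \<or> i = prv m a"
        using that by blast
      then have "i \<in> {1..m}"
        using r by blast
      moreover have "V i \<in> neighbors (helm m) u"
        unfolding a(2) nbs(2)[OF a(1)] using i by blast
      ultimately have "i \<noteq> 0" "V i \<in> neighbors (helm m) u"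
        by simp_all
      then show ?thesis
        using forces_whiteD(4)[OF f, of "V i"] by simp
    qed
    then show ?thesis
      using D_le[of j 2 "V i"] j by simp
  qed
  have nbs_A: "a \<in> A" "nxt m a \<in> A" "prv m a \<in> A"
    using exact[OF a(1)] exact[OF r(1)] exact[OF r(2)] both by simp_all
  then have "a \<in> A - K"
    by (simp add: K_def)
  moreover have "card K + card (A - K) = card A"
    using card_Un_disjoint[of K "A - K"] K_le fin(1) by (simp add: Un_absorb1 finite_subset)
  moreover from calculation have "card (A - K) \<noteq> 0"
    using fin by auto
  ultimately have one: "card (A - K) = 1"
    using le card_A by linarith
  then obtain a' where "A - K = {a'}"
    by (rule card_1_singletonE)
  then have one': "A - K = {a}"
    using \<open>a \<in> A - K\<close> by simp
  have "even (card A + card (A - K))"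
  proof (rule even_card_run_ends)
    show "nxt m i \<in> A \<and> prv m i \<in> A" if "i \<in> A - K" for i
      using that one' nbs_A by simp
  qed (use A_range in \<open>auto simp: K_def\<close>)
  then show ?thesis
    using one by simp
qed

section \<open>Time bounds by the size of the starting set\<close>

lemma all_blue_mono:
  assumes "D j = verts (helm m)" "j \<le> k"
  shows "D k = verts (helm m)"
  using blue_after_mono[OF assms(2), of "helm m" B] assms(1)
    blue_after_subset_verts[OF finite_simple_graph_helm[OF m3] B_verts, of k] by simp

lemma center_white_outer_le:
  assumes "V 0 \<notin> B" "card S \<le> 1" "R \<subseteq> C" "\<And>c. c \<in> R \<Longrightarrow> V c \<in> D 2"
  shows "card R \<le> card S"
  using assms center_white_spokes_2 by (intro card_mono fin) blast

text \<open>There is no slack: \<open>B\<close> consists of half of the pendants, and the center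
  must force a last spoke \<open>V b\<close>. The other spokes over \<open>C\<close> are blue two
  steps before the end; this is impossible at time 2, and at time 3 \<open>center_white_odd\<close>
  applies.\<close>

lemma even_time:
  assumes "2 * card B = m"
  shows "D 4 \<noteq> verts (helm m)"
    and "D 5 = verts (helm m) \<Longrightarrow> odd (card B)"
proof -
  have "card S = 0" "card ({V 0} \<inter> B) = 0"
    using card_lower_bound assms by linarith+
  then have S: "S = {}" and V0: "V 0 \<notin> B"
    using fin by auto
  have card_A: "card A = card B" and card_C: "card C = card A"
    using card_B card_A_C S V0 assms by auto
  obtain b where b: "b \<in> C" "F (V 0) (V b)"
    using center_forces S V0 card_C by (auto simp: insert_Diff_if)
  have card_Cb: "card A = card (C - {b}) + 1" "card (C - {b}) \<ge> 2"
    using b fin card_C card_A assms m5 by auto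
  have late: "V c \<in> D k" if "D (Suc (Suc k)) = verts (helm m)" "c \<in> C - {b}" for c k
    using center_forces_last[OF b(2) outer_blue_before[OF that(1) b(1)]] that(2) C_range by blast
  show "D 4 \<noteq> verts (helm m)"
  proof
    assume "D 4 = verts (helm m)"
    then have "card (C - {b}) \<le> card S"
      using S V0 by (intro center_white_outer_le late) (auto simp: eval_nat_numeral simp del: blue_after.simps)
    then show False
      using card_Cb S by simp
  qed
  show "odd (card B)" if "D 5 = verts (helm m)"
  proof -
    have "D (Suc (Suc 3)) = verts (helm m)"
      using that by (simp add: eval_nat_numeral)
    then have "V c \<in> D 3" if "c \<in> C - {b}" for c
      using late that by blast
    moreover have "C - {b} \<noteq> {}"
      using card_Cb by (metis card.empty not_numeral_le_zero)
    ultimately have "odd (card A)"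
      using S V0 card_Cb card_C by (intro center_white_odd[where R = "C - {b}"]) auto
    then show ?thesis
      using card_A by simp
  qed
qed

text \<open>The slack is one unit, which gives three cases: the center is blue initially, there is
  one more pendant, or one spoke is blue initially. The last is too slow; the others fix the parity
  of \<open>card A\<close>.\<close>

lemma odd_time:
  assumes "2 * card B = m + 1"
  shows "D 3 \<noteq> verts (helm m)"
    and "D 4 = verts (helm m) \<Longrightarrow> m mod 4 = 1"
proof -
  have "D 3 \<noteq> verts (helm m) \<and> (D 4 = verts (helm m) \<longrightarrow> m mod 4 = 1)"
  proof (cases "V 0 \<in> B")
    case True
    then have "card ({V 0} \<inter> B) = 1"
      by simp
    then have "card S = 0"
      using card_lower_bound assms by linarith
    then have S: "S = {}" and "card B = card A + 1"
      using fin card_B \<open>card ({V 0} \<inter> B) = 1\<close> by simp_all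
    then have cards: "2 * card A + 1 = m" "card C = card A + 1" "card A \<ge> 1"
      using card_A_C assms m5 by auto
    have "m mod 4 = 1" if "even (card A)"
      using that cards(1) by presburger
    then show ?thesis
      using center_blue_not_3 center_blue_even True S cards by blast
  next
    case V0: False
    then have sum: "card B = card A + card S" and S1: "card S \<le> 1"
      using card_lower_bound assms card_B by auto
    have all3: "V c \<in> D 3" if "D 4 = verts (helm m)" "c \<in> C" for c
      using outer_blue_before[of 3 c] that by simp
    show ?thesis
    proof (cases "S = {}")
      case True
      then have cards: "2 * card A = m + 1" "card A = card C + 1" "card C \<ge> 2"
        using card_A_C assms m5 sum by auto
      have "D 3 \<noteq> verts (helm m)"
        using center_white_outer_le[OF V0 S1, of C] outer_blue_before[of 2] cards True
        by (auto simp: eval_nat_numeral simp del: blue_after.simps)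
      moreover have "m mod 4 = 1" if "D 4 = verts (helm m)"
      proof -
        have "odd (card A)"
          using V0 True cards all3[OF that] by (intro center_white_odd[where R = C]) auto
        then show ?thesis
          using cards(1) by presburger
      qed
      ultimately show ?thesis
        by blast
    next
      case False
      then have one: "card S = 1"
        using S1 fin card_0_eq[of S] by linarith
      then have cards: "card C = card A + 1" "card C \<ge> 3"
        using card_A_C assms m5 sum by auto
      \<comment> \<open>With the white center as a further target, the spokes over \<open>A\<close>
        do not suffice, so the center forces a last spoke. The rest of \<open>C\<close> would have
        to be blue at time 2, when it can only come from the one-element set
        \<open>S\<close>.\<close>
      have "card (C - S) \<ge> card A"
        using diff_card_le_card_Diff[OF fin(3), of C] cards one by simp
      then obtain b where b: "b \<in> C" "F (V 0) (V b)"
        using center_forces V0 by (auto simp: insert_Diff_if)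
      have "D 4 \<noteq> verts (helm m)"
      proof
        assume "D 4 = verts (helm m)"
        then have b3: "V b \<in> D (Suc 2)"
          using all3[of b] b by (simp add: eval_nat_numeral)
        have "card (C - {b}) \<le> card S"
          using center_forces_last[OF b(2) b3] C_range
          by (intro center_white_outer_le V0 S1) auto
        then show False
          using b fin cards one by simp
      qed
      then show ?thesis
        using all_blue_mono[of 3 4] by auto
    qed
  qed
  then show "D 3 \<noteq> verts (helm m)" "D 4 = verts (helm m) \<Longrightarrow> m mod 4 = 1"
    by blast+
qed

text \<open>For even \<open>m\<close>, \<open>card B\<close> is \<open>m div 2\<close>, which is odd
  exactly if \<open>m mod 4 = 2\<close>; so time 5 is excluded when 4 divides
  \<open>m\<close>.\<close>

lemma time_lower_bound:
  assumes "card B = (m + 1) div 2"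
  shows "(if m mod 4 = 0 then 6 else if m mod 4 = 1 then 4 else 5) \<le> T"
proof (rule ccontr)
  assume "\<not> ?thesis"
  then have T: "T < (if m mod 4 = 0 then 6 else if m mod 4 = 1 then 4 else 5)"
    by simp
  show False
  proof (cases "even m")
    case True
    then have B2: "2 * card B = m"
      using assms by presburger
    show False
    proof (cases "m mod 4 = 0")
      case True
      then have "T \<le> 5"
        using T by simp
      then have "odd (card B)"
        using even_time(2)[OF B2] all_blue_mono[OF all_blue] by blast
      then show False
        using B2 True by presburger
    next
      case False
      then have "T \<le> 4"
        using T by (simp split: if_splits)
      then show False
        using even_time(1)[OF B2] all_blue_mono[OF all_blue] by blast
    qed
  next
    case False
    then have B2: "2 * card B = m + 1"
      using assms by presburger
    show False
    proof (cases "m mod 4 = 1")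
      case True
      then have "T \<le> 3"
        using T by simp
      then show False
        using odd_time(1)[OF B2] all_blue_mono[OF all_blue] by blast
    next
      case not1: False
      have "m mod 4 \<noteq> 0"
        using False by presburger
      then have "T \<le> 4"
        using T not1 by simp
      then show False
        using odd_time(2)[OF B2] not1 all_blue_mono[OF all_blue] by blast
    qed
  qed
qed

end

section \<open>An optimal starting set\<close>

text \<open>Covers a \<open>v\<close> that is already blue, so applications need no check that the
  target is white.\<close>

lemma blue_stepI:
  assumes "u \<in> blue_after G B k" "v \<in> neighbors G u"
    and "neighbors G u \<subseteq> insert v (blue_after G B k)"
  shows "v \<in> blue_after G B (Suc k)"
proof (cases "v \<in> blue_after G B k")
  case False
  then have "forces G (blue_after G B k) u v"
    using assms unfolding forces_def by blast
  then show ?thesis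
    by auto
qed simp

text \<open>Runs of two consecutive pendants, one of them extended to a run of three so that the center
  can be forced. If \<open>4\<close> divides \<open>m\<close>, this is one pendant
  too many, and the index \<open>m - 2\<close> is dropped.\<close>

definition start :: "nat \<Rightarrow> nat set" where
  "start m = insert 1 {i. i < m \<and> i mod 4 \<in> {2, 3} \<and> \<not> (4 dvd m \<and> m = i + 2)}"

lemma card_mod4_2_3:
  "card {i. i < m \<and> i mod 4 \<in> {2, 3 :: nat}} = 2 * (m div 4) + (if m mod 4 = 3 then 1 else 0)"
proof (induction m)
  case (Suc m)
  have "{i. i < Suc m \<and> i mod 4 \<in> {2, 3}} =
    (if m mod 4 \<in> {2, 3} then insert m {i. i < m \<and> i mod 4 \<in> {2, 3}}
     else {i. i < m \<and> i mod 4 \<in> {2, 3 :: nat}})"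
    by (auto simp: less_Suc_eq)
  then have "card {i. i < Suc m \<and> i mod 4 \<in> {2, 3}} =
    2 * (m div 4) + (if m mod 4 = 3 then 1 else 0) + (if m mod 4 \<in> {2, 3} then 1 else 0)"
    using Suc.IH by auto
  moreover have "m mod 4 < 4"
    by simp
  ultimately show ?case
    by (auto simp: mod_Suc div_Suc split: if_splits)
qed simp

lemma card_start:
  assumes "m \<ge> 5"
  shows "card (start m) \<le> (m + 1) div 2"
proof -
  let ?R = "{i. i < m \<and> i mod 4 \<in> {2, 3}}"
  have "card (start m) \<le> card {i. i < m \<and> i mod 4 \<in> {2, 3} \<and> \<not> (4 dvd m \<and> m = i + 2)} + 1"
    unfolding start_def by (simp add: card_insert_if)
  moreover have "card {i. i < m \<and> i mod 4 \<in> {2, 3} \<and> \<not> (4 dvd m \<and> m = i + 2)} =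
    card ?R - (if 4 dvd m then 1 else 0)"
  proof (cases "4 dvd m")
    case True
    obtain j where j: "m = j + 2"
      using assms by (intro that[of "m - 2"]) simp
    then have "j mod 4 = 2"
      using True by presburger
    then have "j \<in> ?R"
      using j by simp
    moreover have "{i. i < m \<and> i mod 4 \<in> {2, 3} \<and> \<not> (4 dvd m \<and> m = i + 2)} = ?R - {j}"
      using True j by auto
    ultimately show ?thesis
      using True by (simp add: card_Diff_singleton)
  qed simp
  \<comment> \<open>Keeps the subtraction for the dropped index from truncating at 0.\<close>
  moreover have "2 * (m div 4) \<ge> 1"
    using assms by simp
  ultimately have "card (start m) \<le>
      2 * (m div 4) + (if m mod 4 = 3 then 1 else 0) + (if m mod 4 = 0 then 0 else 1)"
    unfolding card_mod4_2_3 by (simp add: mod_eq_0_iff_dvd split: if_splits)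
  also have "\<dots> \<le> (m + 1) div 2"
  proof (cases "m mod 4 = 0 \<or> m mod 4 = 3")
    case True
    then show ?thesis
      by (elim disjE; simp; presburger)
  next
    case False
    then show ?thesis
      by simp presburger
  qed
  finally show ?thesis .
qed

section \<open>Propagation from the optimal starting set\<close>

context
  fixes m :: nat and D :: "nat \<Rightarrow> helm_vertex set"
  assumes m: "m \<ge> 5"
    and D_def: "D = blue_after (helm m) (P ` start m)"
begin

lemma start_range: "start m \<subseteq> {1..m}"
proof
  fix i
  assume "i \<in> start m"
  then have "i = 1 \<or> i < m \<and> i mod 4 \<noteq> 0"
    by (auto simp: start_def)
  moreover have "i \<noteq> 0" if "i mod 4 \<noteq> 0"
    using that by (rule contrapos_nn) simp
  ultimately show "i \<in> {1..m}"
    using m by auto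
qed

lemma start_blue_le: "j \<le> k \<Longrightarrow> x \<in> D j \<Longrightarrow> x \<in> D k"
  unfolding D_def using blue_after_mono[of j k "helm m" "P ` start m"] by blast

lemma start_stepI:
  assumes "u \<in> D k" "v \<in> neighbors (helm m) u" "neighbors (helm m) u \<subseteq> insert v (D k)"
  shows "v \<in> D (Suc k)"
  by (rule blue_stepI[OF assms[unfolded D_def], folded D_def])

lemma start_blue_0: "i \<in> start m \<Longrightarrow> P i \<in> D k"
  by (rule start_blue_le[of 0]) (auto simp: D_def)

lemma start_blue_1:
  assumes "i \<in> start m" "1 \<le> k"
  shows "V i \<in> D k"
proof -
  have "V i \<in> D (Suc 0)"
    by (rule start_stepI[where u = "P i"])
      (use assms start_blue_0 start_range neighbors_pendant[of i m] in auto)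
  then show ?thesis
    by (rule start_blue_le[rotated]) (use assms in simp)
qed

lemma neighbors_start: "i \<in> {1..m} \<Longrightarrow>
    neighbors (helm m) (V i) = {V 0, P i, V (nxt m i), V (prv m i)}"
  using m by (intro neighbors_spoke) auto

text \<open>The run 1, 2, 3 does this: at time 1 \<open>V 2\<close> has only the center left as a
  possibly white neighbour.\<close>

lemma start_center:
  assumes "2 \<le> k"
  shows "V 0 \<in> D k"
proof -
  have s: "1 \<in> start m" "2 \<in> start m" "3 \<in> start m"
    using m by (auto simp: start_def)
  have "V 0 \<in> D (Suc 1)"
  proof (rule start_stepI[where u = "V 2"])
    show "V 2 \<in> D 1"
      using start_blue_1 s by blast
    show "V 0 \<in> neighbors (helm m) (V 2)"
      using neighbors_start[of 2] m by auto
    show "neighbors (helm m) (V 2) \<subseteq> insert (V 0) (D 1)"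
      using neighbors_start[of 2] m start_blue_0[OF s(2)] start_blue_1[OF s(1), of 1] start_blue_1[OF s(3), of 1]
      by (auto simp: nxt_def prv_def)
  qed
  then show ?thesis
    by (rule start_blue_le[rotated]) (use assms in simp)
qed

lemma start_rim_force:
  assumes "2 \<le> k" "i \<in> start m" "c \<in> {nxt m i, prv m i}"
    and "\<And>d. d \<in> {nxt m i, prv m i} \<Longrightarrow> d \<noteq> c \<Longrightarrow> V d \<in> D k"
  shows "V c \<in> D (Suc k)"
proof -
  have i: "i \<in> {1..m}"
    using assms(2) start_range by blast
  show ?thesis
  proof (rule start_stepI[where u = "V i"])
    show "V i \<in> D k"
      using start_blue_1[OF assms(2), of k] assms(1) by simp
    show "V c \<in> neighbors (helm m) (V i)"
      using neighbors_start[OF i] assms(3) by blast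
    show "neighbors (helm m) (V i) \<subseteq> insert (V c) (D k)"
      unfolding neighbors_start[OF i]
      using start_blue_0[OF assms(2)] start_center[OF assms(1)] assms(4) by blast
  qed
qed

text \<open>A spoke outside \<open>start m\<close> is forced by the adjacent end of a run:
  \<open>m\<close> by 1, other multiples of 4 by the run before them, residue 1 by the run after it.
  The exceptions are the index before the run cut short near \<open>m\<close> and the dropped
  index.\<close>

lemma start_blue_3:
  assumes c: "c \<in> {1..m}" and late: "\<not> (c mod 4 = 1 \<and> c < m \<and> m \<le> c + 3)" "\<not> (4 dvd m \<and> m = c + 2)"
  shows "V c \<in> D 3"
proof -
  have "\<exists>i\<in>start m. c \<in> {nxt m i, prv m i} \<and> (\<forall>d\<in>{nxt m i, prv m i}. d \<noteq> c \<longrightarrow> d \<in> start m)"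
    if nc: "c \<notin> start m"
  proof -
    consider "c = m" | "c < m" "c mod 4 = 0" | "c + 3 < m" "c mod 4 = 1" "c \<ge> 5"
    proof -
      have "c mod 4 < 4" "c \<noteq> 1" "c < m \<Longrightarrow> c mod 4 \<noteq> 2 \<and> c mod 4 \<noteq> 3"
        using nc late(2) by (auto simp: start_def)
      moreover have "c \<ge> 5" if "c mod 4 = 1" "c \<noteq> 1"
        using that by presburger
      ultimately show thesis
        using that c late(1) by (cases "c mod 4 = 1"; cases "c = m") auto
    qed
    then show ?thesis
    proof cases
      case 1
      then show ?thesis
        using m by (intro bexI[of _ 1]) (auto simp: start_def nxt_def prv_def)
    next
      case 2
      then have "4 dvd c"
        by (simp add: mod_eq_0_iff_dvd)
      then obtain q where q: "c = 4 * q"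
        by (rule dvdE)
      then obtain j where j: "c = 4 * j + 4"
        using c by (cases q) auto
      have "4 * j + 2 \<in> start m" "4 * j + 3 \<in> start m"
        using 2(1) unfolding j start_def by simp_all presburger+
      moreover have "nxt m (4 * j + 3) = c" "prv m (4 * j + 3) = 4 * j + 2"
        using 2(1) j by (auto simp: nxt_def prv_def)
      ultimately show ?thesis
        by (intro bexI[of _ "4 * j + 3"]) auto
    next
      case 3
      have "(c + 1) mod 4 = 2" "(c + 2) mod 4 = 3" "\<not> (4 dvd m \<and> m = c + 2 + 2)"
        using 3(2) by presburger+
      then have "c + 1 \<in> start m" "c + 2 \<in> start m"
        using 3(1) unfolding start_def by simp_all
      moreover have "nxt m (c + 1) = c + 2" "prv m (c + 1) = c"
        using 3(1) c by (simp_all add: nxt_def prv_def)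
      ultimately show ?thesis
        by (intro bexI[of _ "c + 1"]) auto
    qed
  qed
  then have "V c \<in> D (Suc 2)"
    using start_rim_force[of 2 _ c] start_blue_1 by (meson le_SucI one_le_numeral order_refl)
  then show ?thesis
    by simp
qed

lemma start_center_force:
  assumes "2 \<le> k" "b \<in> {1..m}" "\<And>c. c \<in> {1..m} \<Longrightarrow> c \<noteq> b \<Longrightarrow> V c \<in> D k"
  shows "c \<in> {1..m} \<Longrightarrow> V c \<in> D (Suc k)"
proof (cases "c = b")
  case True
  show ?thesis
    unfolding True
  proof (rule start_stepI[where u = "V 0"])
    show "V 0 \<in> D k"
      by (rule start_center) fact
    have N: "neighbors (helm m) (V 0) = V ` {1..m}"
      using m by (intro neighbors_center) simp
    show "V b \<in> neighbors (helm m) (V 0)" "neighbors (helm m) (V 0) \<subseteq> insert (V b) (D k)"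
      unfolding N using assms by blast+
  qed
next
  case False
  then show "c \<in> {1..m} \<Longrightarrow> ?thesis"
    using assms(3) start_blue_le[of k "Suc k"] by simp
qed

lemma start_finish:
  assumes "2 \<le> k" "\<And>c. c \<in> {1..m} \<Longrightarrow> V c \<in> D k"
  shows "D (Suc k) = verts (helm m)"
proof
  have "finite_simple_graph (helm m)"
    using m by (intro finite_simple_graph_helm) simp
  moreover have "P ` start m \<subseteq> verts (helm m)"
    using start_range by (auto simp: helm_def)
  ultimately show "D (Suc k) \<subseteq> verts (helm m)"
    unfolding D_def by (rule blue_after_subset_verts)
  have "P c \<in> D (Suc k)" if c: "c \<in> {1..m}" for c
  proof (rule start_stepI[where u = "V c"])
    show "V c \<in> D k"
      by (rule assms(2)[OF c])
    show "P c \<in> neighbors (helm m) (V c)"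
      "neighbors (helm m) (V c) \<subseteq> insert (P c) (D k)"
      unfolding neighbors_start[OF c] using nxt_prv_range[OF c] assms(2) start_center[OF assms(1)] by auto
  qed
  moreover have "V c \<in> D (Suc k)" if "c \<in> {0..m}" for c
    using start_center[OF assms(1)] assms(2)[of c] start_blue_le[of k "Suc k"] that
    by (cases "c = 0") auto
  ultimately show "verts (helm m) \<subseteq> D (Suc k)"
    by (auto simp: helm_def)
qed

lemma start_time:
  "D (if m mod 4 = 0 then 6 else if m mod 4 = 1 then 4 else 5) = verts (helm m)"
proof -
  \<comment> \<open>Only the three indices before \<open>m\<close> can be late.\<close>
  obtain n where n: "m = n + 3" "n \<ge> 2"
    using m by (intro that[of "m - 3"]) simp_all
  then have range: "n \<in> {1..m}" "n + 1 \<in> {1..m}" "n + 2 \<in> {1..m}"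
    by simp_all
  have D3: "V c \<in> D 3"
    if "c \<in> {1..m}" "\<not> (c mod 4 = 1 \<and> c \<in> {n, n + 1, n + 2})" "\<not> (m mod 4 = 0 \<and> c = n + 1)" for c
    using that n by (intro start_blue_3) (auto simp: mod_eq_0_iff_dvd)
  have finish: "D (Suc (Suc k)) = verts (helm m)"
    if "2 \<le> k" "b \<in> {1..m}" "\<And>c. c \<in> {1..m} \<Longrightarrow> c \<noteq> b \<Longrightarrow> V c \<in> D k" for b k
    using that by (intro start_finish start_center_force[of k b]) simp_all
  have "m mod 4 < 4"
    by simp
  then consider "m mod 4 = 0" | "m mod 4 = 1" | "m mod 4 = 2" | "m mod 4 = 3"
    by linarith
  then show ?thesis
  proof cases
    case 1
    then have mod4: "n mod 4 = 1"
      using n by presburger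
    \<comment> \<open>Dropping \<open>n + 1\<close> leaves \<open>n + 2\<close> isolated in
      \<open>start m\<close>. Since \<open>V m\<close> is blue at time 3, \<open>V (n + 2)\<close>
      forces \<open>V (n + 1)\<close> in step 4; \<open>V n\<close> is left to the center in step
      5.\<close>
    have "V c \<in> D 4" if c: "c \<in> {1..m}" "c \<noteq> n" for c
    proof (cases "c = n + 1")
      case True
      have "n + 2 \<in> start m"
        using mod4 n unfolding start_def by simp presburger
      moreover have "nxt m (n + 2) = m" "prv m (n + 2) = n + 1"
        using n by (auto simp: nxt_def prv_def)
      moreover have "V m \<in> D 3"
        using D3[of m] n by simp
      ultimately show ?thesis
        using start_rim_force[of 3 "n + 2" c] True by simp
    next
      case False
      have "(n + 1) mod 4 \<noteq> 1" "(n + 2) mod 4 \<noteq> 1"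
        using mod4 by presburger+
      then have "V c \<in> D 3"
        using c False by (intro D3) auto
      then show ?thesis
        by (rule start_blue_le[rotated]) simp
    qed
    then have "D (Suc (Suc 4)) = verts (helm m)"
      by (intro finish[OF _ range(1)]) auto
    then show ?thesis
      using 1 by simp
  next
    case 2
    then have "n mod 4 \<noteq> 1" "(n + 1) mod 4 \<noteq> 1" "(n + 2) mod 4 \<noteq> 1"
      using n by presburger+
    then have "V c \<in> D 3" if "c \<in> {1..m}" for c
      using that 2 by (intro D3) auto
    then have "D (Suc 3) = verts (helm m)"
      by (intro start_finish) auto
    then show ?thesis
      using 2 by simp
  next
    case 3
    then have "n mod 4 \<noteq> 1" "(n + 1) mod 4 \<noteq> 1"
      using n by presburger+
    then have "V c \<in> D 3" if "c \<in> {1..m}" "c \<noteq> n + 2" for c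
      using that 3 by (intro D3) auto
    then have "D (Suc (Suc 3)) = verts (helm m)"
      by (intro finish[OF _ range(3)]) auto
    then show ?thesis
      using 3 by simp
  next
    case 4
    then have "n mod 4 \<noteq> 1" "(n + 2) mod 4 \<noteq> 1"
      using n by presburger+
    then have "V c \<in> D 3" if "c \<in> {1..m}" "c \<noteq> n + 1" for c
      using that 4 by (intro D3) auto
    then have "D (Suc (Suc 3)) = verts (helm m)"
      by (intro finish[OF _ range(2)]) auto
    then show ?thesis
      using 4 by simp
  qed
qed

end

theorem theorem3p9:
  fixes m :: nat
  assumes "m \<ge> 5"
  shows "propagation_time (helm m) =
           (if m mod 4 = 0 then 6
            else if m mod 4 = 1 then 4
            else if m mod 4 = 2 then 5
            else 5)"
proof -
  let ?t = "if m mod 4 = 0 then 6 else if m mod 4 = 1 then 4 else 5 :: nat"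
  have G: "finite_simple_graph (helm m)"
    using assms by (intro finite_simple_graph_helm) simp
  have B: "P ` start m \<subseteq> verts (helm m)"
    using start_range[OF assms] by (auto simp: helm_def)
  have blue: "blue_after (helm m) (P ` start m) ?t = verts (helm m)"
    using start_time[OF assms] by blast
  have lower: "(m + 1) div 2 \<le> card B'"
    if "B' \<subseteq> verts (helm m)" "blue_after (helm m) B' k = verts (helm m)" for B' k
  proof -
    interpret helm_forcing m B' k
      by standard (use assms that in auto)
    show ?thesis
      using card_lower_bound by linarith
  qed
  \<comment> \<open>The general lower bound, applied to the starting set itself, turns
    \<open>card_start\<close> into an equality.\<close>
  have "card (P ` start m) = (m + 1) div 2"
    using lower[OF B blue] card_start[OF assms] by (simp add: card_image inj_on_def)
  then have "propagation_time (helm m) = ?t"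
  proof (rule propagation_time_eqI[OF G B _ blue lower])
    show "?t \<le> k"
      if "B' \<subseteq> verts (helm m)" "blue_after (helm m) B' k = verts (helm m)"
        and "card B' = (m + 1) div 2" for B' k
    proof -
      interpret helm_forcing m B' k
        by standard (use assms that in auto)
      show ?thesis
        by (rule time_lower_bound) fact
    qed
  qed
  then show ?thesis
    by simp
qed

end
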